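(* Let $T$ be an $N\times N$ GSE (Gaussian symplectic ensemble) matrix. Then for all $n\ge1$, $\iota:\pm[n]\to[N]$ and $\eta:\pm[n]\to\{1,-1\}$, $$\mathbb{E}\Big(\prod_{k=1}^{n}T_{\iota_k\iota_{-k};\eta_k\eta_{-k}}\Big)=\sum_{\substack{\alpha\in\mathrm{PM}(n)\\ \iota=\iota\circ\delta\alpha\\ \mathrm{sgn}\cdot\eta=(\mathrm{sgn}\circ\alpha)\cdot(\eta\circ\delta\alpha)}}\Big[\prod_{\substack{k\in[n]\\ -k\in\mathrm{FD}(\alpha)}}\eta_k\eta_{-k}\Big](2N)^{\#(\alpha)/2-n}f(\alpha),$$ where $f:\mathrm{PM}(n)\to\mathbb{C}$ is defined by $f(\alpha)=1$ if $\alpha\in\mathcal{P}_2(\pm[n])$ and $f(\alpha)=0$ otherwise.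
   Context: A standard quaternionic Gaussian random variable is $\xi_0+i\xi_1+j\xi_2+k\xi_3$ with $\xi_0,\dots,\xi_3$ independent real $N(0,\tfrac14)$ variables. A GSE matrix is $T=\frac1{\sqrt{2N}}(G+G^* )$ where $G$ is $N\times N$ with independent standard quaternionic Gaussian entries and $G^*$ is its conjugate transpose. The quaternion $a+bi+cj+dk$ is represented by the $2\times2$ complex matrix $\begin{pmatrix}a+bi&c+di\\-c+di&a-bi\end{pmatrix}$, rows and columns indexed by $1,-1$ in this order; $A_{\iota_1\iota_2;\eta_1\eta_2}$ is the $(\eta_1,\eta_2)$ entry of the matrix representing the quaternion $A_{\iota_1\iota_2}$. $[n]=\{1,\dots,n\}$, $\pm[n]=[n]\cup(-[n])$, $\delta:k\mapsto-k$, $\mathrm{sgn}(k)$ is the sign of the integer $k$, $\cdot$ is pointwise multiplication of functions, $\#(\alpha)$ is the number of orbits of $\alpha$ on $\pm[n]$. $\mathrm{PM}(n)$ is the set of permutations $\pi$ of $\pm[n]$ with $\delta\pi\delta=\pi^{-1}$ and no $k,-k$ in the same cycle. Its cycles come in pairs (order and signs reversed); $\mathrm{FD}(\pi)$ is the set of elements of those cycles, one from each pair, in which the element of smallest absolute value is positive. $\mathcal{P}_2(\pm[n])$ is the set of pairings (permutations all of whose cycles have exactly two elements). *)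

theory Defs
  imports "HOL-Probability.Probability" "HOL-Combinatorics.Combinatorics"
begin

(* The quaternion a + b i + c j + d k is the tuple (a, b, c, d); addition, real scaling and the
   Borel sets are those of the product type. Quaternion multiplication is not needed. *)
type_synonym quat = "real \<times> real \<times> real \<times> real"

fun quat_cnj :: "quat \<Rightarrow> quat" where
  "quat_cnj (a, b, c, d) = (a, -b, -c, -d)"

(* Entries of the 2 x 2 complex matrix representing a quaternion, rows and columns indexed by
   1, -1 in this order. The value at other indices is an arbitrary 0. *)
fun quat_entry :: "quat \<Rightarrow> int \<Rightarrow> int \<Rightarrow> complex" where
  "quat_entry (a, b, c, d) r s =
     (if r = 1 \<and> s = 1 then Complex a b
      else if r = 1 \<and> s = -1 then Complex c d
      else if r = -1 \<and> s = 1 then Complex (-c) d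
      else if r = -1 \<and> s = -1 then Complex a (-b)
      else 0)"

(* The second argument of normal_density is the standard deviation, so the variance is 1/4. *)
definition std_quat_gaussian :: "'a measure \<Rightarrow> ('a \<Rightarrow> quat) \<Rightarrow> bool" where
  "std_quat_gaussian M X \<longleftrightarrow>
     (\<exists>\<xi> :: nat \<Rightarrow> 'a \<Rightarrow> real.
        prob_space.indep_vars M (\<lambda>_. borel) \<xi> {0..3} \<and>
        (\<forall>l\<in>{0..3}. distributed M lborel (\<xi> l) (normal_density 0 (1/2))) \<and>
        (\<forall>\<omega>\<in>space M. X \<omega> = (\<xi> 0 \<omega>, \<xi> 1 \<omega>, \<xi> 2 \<omega>, \<xi> 3 \<omega>)))"

(* Random N x N matrices are indexed by 1..N; entries outside this range are irrelevant. *)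
definition is_GSE :: "'a measure \<Rightarrow> nat \<Rightarrow> (nat \<Rightarrow> nat \<Rightarrow> 'a \<Rightarrow> quat) \<Rightarrow> bool" where
  "is_GSE M N T \<longleftrightarrow>
     (\<exists>G :: nat \<Rightarrow> nat \<Rightarrow> 'a \<Rightarrow> quat.
        prob_space.indep_vars M (\<lambda>_. borel) (\<lambda>(i, j). G i j) ({1..N} \<times> {1..N}) \<and>
        (\<forall>i\<in>{1..N}. \<forall>j\<in>{1..N}. std_quat_gaussian M (G i j)) \<and>
        (\<forall>i\<in>{1..N}. \<forall>j\<in>{1..N}. \<forall>\<omega>\<in>space M.
           T i j \<omega> = (1 / sqrt (2 * real N)) *\<^sub>R (G i j \<omega> + quat_cnj (G j i \<omega>))))"

definition pm :: "nat \<Rightarrow> int set" where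
  "pm n = {1..int n} \<union> uminus ` {1..int n}"

definition num_orbits :: "nat \<Rightarrow> (int \<Rightarrow> int) \<Rightarrow> nat" where
  "num_orbits n \<alpha> = card (orbit \<alpha> ` pm n)"

definition PM :: "nat \<Rightarrow> (int \<Rightarrow> int) set" where
  "PM n = {\<pi>. \<pi> permutes pm n \<and> uminus \<circ> \<pi> \<circ> uminus = inv \<pi> \<and>
             (\<forall>k\<in>pm n. -k \<notin> orbit \<pi> k)}"

(* The orbit of k is the set of elements of the cycle containing k, and m is its element of
   smallest absolute value. *)
definition FD :: "nat \<Rightarrow> (int \<Rightarrow> int) \<Rightarrow> int set" where
  "FD n \<pi> = {k \<in> pm n. \<exists>m\<in>orbit \<pi> k. (\<forall>l\<in>orbit \<pi> k. \<bar>m\<bar> \<le> \<bar>l\<bar>) \<and> 0 < m}"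

definition pairings :: "int set \<Rightarrow> (int \<Rightarrow> int) set" where
  "pairings A = {\<pi>. \<pi> permutes A \<and> (\<forall>k\<in>A. card (orbit \<pi> k) = 2)}"

definition f_GSE :: "nat \<Rightarrow> (int \<Rightarrow> int) \<Rightarrow> complex" where
  "f_GSE n \<alpha> = (if \<alpha> \<in> pairings (pm n) then 1 else 0)"

end

theory Submission imports Defs begin

text \<open>
  The entries of the matrix are complex linear forms in the real coordinates of the Gaussian
  quaternions \<open>G i j\<close>, which are independent and $N(0,\frac14)$. Hence the expectation of a
  product of entries obeys Wick's rule: it is a sum over the pairings of the factors, each pair
  contributing its covariance. Everything specific to the ensemble sits in that covariance
  (\<open>gse_covariance\<close>): for \<open>k \<noteq> l\<close> the covariance of the factors \<open>k\<close> and \<open>l\<close> is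
  $\frac1{2N}$ times a sum of \<^emph>\<open>two\<close> terms. One comes from \<open>G\<close> meeting its conjugate
  transpose and matches the row index of one factor with the column index of the other; the other comes from \<open>G\<close> meeting
  \<open>G\<close>, which correlate because opposite entries of the complex matrix of a quaternion are conjugate
  up to sign, and it matches rows with rows and columns with columns, with a sign
  $\eta_k\eta_{-k}$.

  Thus a pair \<open>{k, l}\<close> in Wick's sum has to carry a choice between \<open>l\<close> and \<open>-l\<close>, and such pairings
  decorated by choices are precisely the odd fixed-point-free involutions of $\pm[n]$ which never
  map \<open>k\<close> to \<open>-k\<close>, by the correspondence \<open>\<alpha> k = l\<close> or \<open>\<alpha> k = - l\<close>. These \<open>signed_pairings\<close> are
  the pairings in \<open>PM n\<close> (\<open>PM_pairings_eq\<close>), that is, the permutations on which \<open>f_GSE\<close> does not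
  vanish. The first of the two covariance terms is the weight of \<open>\<alpha> k = l\<close>, the second that of
  \<open>\<alpha> k = - l\<close>, and the index conditions of the theorem are the conjunction over all pairs of the
  conditions under which the chosen terms are nonzero (\<open>pairing_weight_gse\<close>). A permutation of this
  kind has \<open>n\<close> cycles, so $(2N)^{\#(\alpha)/2-n} = (2N)^{-n/2}$ is the product of the factors
  $\frac1{2N}$ of its $n/2$ pairs.

  Both sides are compared by the same recursion, which pairs off the largest index with each of the
  others: \<open>wick_recursion\<close> for the moments and \<open>sum_signed_pairings_insert\<close> for the sum over signed
  pairings. Covariances enter the first where sums \<open>w k l + w k (- l)\<close> of weights enter the second,
  so \<open>form_moment_signed_pairings\<close> follows by induction.
\<close>

section \<open>Mixed moments of independent Gaussian variables\<close>

definition gauss_moment :: "real \<Rightarrow> nat \<Rightarrow> real" where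
  "gauss_moment \<sigma> m = (\<integral>x. normal_density 0 \<sigma> x * x ^ m \<partial>lborel)"

lemma gauss_moment_even:
  "0 < \<sigma> \<Longrightarrow> gauss_moment \<sigma> (2 * k) = fact (2 * k) / ((2 / \<sigma>\<^sup>2) ^ k * fact k)"
  using integral_normal_moment_even[of \<sigma> 0 k] by (simp add: gauss_moment_def)

lemma gauss_moment_odd: "0 < \<sigma> \<Longrightarrow> gauss_moment \<sigma> (2 * k + 1) = 0"
  using integral_normal_moment_odd[of \<sigma> 0 k] by (simp add: gauss_moment_def)

lemma gauss_moment_0: "0 < \<sigma> \<Longrightarrow> gauss_moment \<sigma> 0 = 1"
  using gauss_moment_even[of \<sigma> 0] by simp

lemma gauss_moment_1: "0 < \<sigma> \<Longrightarrow> gauss_moment \<sigma> (Suc 0) = 0"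
  using gauss_moment_odd[of \<sigma> 0] by simp

text \<open>
  This is Gaussian integration by parts for the function $x^{m+1}$; it is read off from the closed
  form of the moments.
\<close>
lemma gauss_moment_Suc_Suc:
  assumes "0 < \<sigma>"
  shows "gauss_moment \<sigma> (Suc (Suc m)) = real (Suc m) * \<sigma>\<^sup>2 * gauss_moment \<sigma> m"
proof (cases "even m")
  case True
  then obtain k where m: "m = 2 * k" by (elim evenE)
  have "gauss_moment \<sigma> (2 * Suc k) = real (Suc (2 * k)) * \<sigma>\<^sup>2 * gauss_moment \<sigma> (2 * k)"
    unfolding gauss_moment_even[OF assms]
    using assms by (simp add: divide_simps)
  then show ?thesis by (simp add: m)
next
  case False
  then obtain k where m: "m = 2 * k + 1" by (elim oddE)
  have "gauss_moment \<sigma> (2 * Suc k + 1) = 0" "gauss_moment \<sigma> (2 * k + 1) = 0"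
    using gauss_moment_odd[OF assms] by blast+
  then show ?thesis by (simp add: m)
qed

text \<open>
  This records the only consequence of being independent $N(0,\sigma^2)$ variables that Wick's rule
  needs: monomials are integrable and their expectation factorises. In this form the property
  passes from the coordinates of one quaternion to those of a whole matrix without first having to
  establish joint independence of all real coordinates.
\<close>
definition iid_gaussian_moments ::
  "'a measure \<Rightarrow> real \<Rightarrow> 'b set \<Rightarrow> ('b \<Rightarrow> 'a \<Rightarrow> real) \<Rightarrow> bool" where
  "iid_gaussian_moments M \<sigma> A X \<longleftrightarrow>
     (\<forall>m. has_bochner_integral M (\<lambda>\<omega>. \<Prod>b\<in>A. X b \<omega> ^ m b) (\<Prod>b\<in>A. gauss_moment \<sigma> (m b)))"

lemma (in prob_space) has_bochner_integral_prod_indep: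
  fixes X :: "'i \<Rightarrow> 'a \<Rightarrow> real"
  assumes "finite I" "indep_vars (\<lambda>_. borel) X I"
    and "\<And>i. i \<in> I \<Longrightarrow> has_bochner_integral M (X i) (x i)"
  shows "has_bochner_integral M (\<lambda>\<omega>. \<Prod>i\<in>I. X i \<omega>) (\<Prod>i\<in>I. x i)"
  using indep_vars_lebesgue_integral[OF assms(1,2)] indep_vars_integrable[OF assms(1,2)] assms(3)
  by (simp add: has_bochner_integral_iff)

lemma (in prob_space) iid_gaussian_moments_indep:
  assumes "0 < \<sigma>" "finite A" "indep_vars (\<lambda>_. borel) X A"
    and "\<And>b. b \<in> A \<Longrightarrow> distributed M lborel (X b) (normal_density 0 \<sigma>)"
  shows "iid_gaussian_moments M \<sigma> A X"
  unfolding iid_gaussian_moments_def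
proof (intro allI has_bochner_integral_prod_indep)
  fix m :: "'b \<Rightarrow> nat"
  show "indep_vars (\<lambda>_. borel) (\<lambda>b \<omega>. X b \<omega> ^ m b) A"
    by (rule indep_vars_compose2[OF assms(3), where Y = "\<lambda>b x. x ^ m b"]) auto
  fix b assume "b \<in> A"
  note D = assms(4)[OF this]
  show "has_bochner_integral M (\<lambda>\<omega>. X b \<omega> ^ m b) (gauss_moment \<sigma> (m b))"
    using distributed_integrable[OF D, of "\<lambda>x. x ^ m b"] distributed_integral[OF D, of "\<lambda>x. x ^ m b"]
      integrable_normal_moment[OF assms(1), of 0 "m b"]
    by (simp add: has_bochner_integral_iff gauss_moment_def)
qed (use assms in auto)

text \<open>
  A monomial in the coordinates \<open>h l\<close> of the independent vectors \<open>G i\<close> is a product over \<open>i\<close> of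
  functions of \<open>G i\<close> alone. Independence across \<open>i\<close> factorises it, and the hypothesis on each
  single vector evaluates the factors.
\<close>
lemma (in prob_space) iid_gaussian_moments_Sigma:
  fixes G :: "'i \<Rightarrow> 'a \<Rightarrow> 'q::topological_space"
  assumes "finite I" "finite L" and ind: "indep_vars (\<lambda>_. borel) G I"
    and comp: "\<And>l. l \<in> L \<Longrightarrow> h l \<in> borel_measurable borel"
    and gauss: "\<And>i. i \<in> I \<Longrightarrow> iid_gaussian_moments M \<sigma> L (\<lambda>l \<omega>. h l (G i \<omega>))"
  shows "iid_gaussian_moments M \<sigma> (I \<times> L) (\<lambda>b \<omega>. h (snd b) (G (fst b) \<omega>))"
  unfolding iid_gaussian_moments_def
proof (intro allI)
  fix m :: "'i \<times> 'b \<Rightarrow> nat"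
  have "has_bochner_integral M (\<lambda>\<omega>. \<Prod>i\<in>I. \<Prod>l\<in>L. h l (G i \<omega>) ^ m (i, l))
          (\<Prod>i\<in>I. \<Prod>l\<in>L. gauss_moment \<sigma> (m (i, l)))"
  proof (rule has_bochner_integral_prod_indep)
    show "indep_vars (\<lambda>_. borel) (\<lambda>i \<omega>. \<Prod>l\<in>L. h l (G i \<omega>) ^ m (i, l)) I"
      by (rule indep_vars_compose2[OF ind, where Y = "\<lambda>i q. \<Prod>l\<in>L. h l q ^ m (i, l)"])
        (intro borel_measurable_prod borel_measurable_power comp)
    show "has_bochner_integral M (\<lambda>\<omega>. \<Prod>l\<in>L. h l (G i \<omega>) ^ m (i, l))
        (\<Prod>l\<in>L. gauss_moment \<sigma> (m (i, l)))" if "i \<in> I" for i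
      using gauss[OF that, unfolded iid_gaussian_moments_def, rule_format, of "\<lambda>l. m (i, l)"] .
  qed fact
  then show "has_bochner_integral M (\<lambda>\<omega>. \<Prod>b\<in>I \<times> L. h (snd b) (G (fst b) \<omega>) ^ m b)
          (\<Prod>b\<in>I \<times> L. gauss_moment \<sigma> (m b))"
    by (simp add: prod.cartesian_product split_def)
qed

section \<open>Wick's rule for linear forms\<close>

text \<open>
  The expectation of $\prod_{k\in K} X_{\phi(k)}$ for independent $N(0,\sigma^2)$ variables
  \<open>X b\<close>: the exponent of \<open>X b\<close> in this product is the size of the fibre of \<open>\<phi>\<close> over \<open>b\<close>.
\<close>
definition mixed_moment :: "real \<Rightarrow> 'b set \<Rightarrow> 'k set \<Rightarrow> ('k \<Rightarrow> 'b) \<Rightarrow> real" where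
  "mixed_moment \<sigma> A K \<phi> = (\<Prod>b\<in>A. gauss_moment \<sigma> (card {k \<in> K. \<phi> k = b}))"

lemma has_bochner_integral_monomial:
  assumes "iid_gaussian_moments M \<sigma> A X" "finite A" "finite K" "\<phi> \<in> K \<rightarrow> A"
  shows "has_bochner_integral M (\<lambda>\<omega>. \<Prod>k\<in>K. X (\<phi> k) \<omega>) (mixed_moment \<sigma> A K \<phi>)"
proof -
  have "(\<Prod>k\<in>K. X (\<phi> k) \<omega>) = (\<Prod>b\<in>A. X b \<omega> ^ card {k \<in> K. \<phi> k = b})" for \<omega>
  proof -
    have "(\<Prod>k\<in>K. X (\<phi> k) \<omega>) = (\<Prod>b\<in>A. \<Prod>k\<in>{k \<in> K. \<phi> k = b}. X (\<phi> k) \<omega>)"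
      using assms by (intro prod.group[symmetric]) auto
    then show ?thesis by simp
  qed
  then show ?thesis
    using assms(1) by (simp add: iid_gaussian_moments_def mixed_moment_def)
qed

text \<open>
  Integration by parts in the variable $X_a$, $a = \phi(k_0)$. If \<open>a\<close> is the value of \<open>\<phi>\<close> at \<open>c\<close>
  indices of \<open>K\<close>, the left side contains the moment of order $c+1$, which is $c\,\sigma^2$ times
  the moment of order $c-1$; the sum on the right has exactly these \<open>c\<close> nonzero terms, all equal.
\<close>
lemma mixed_moment_insert:
  assumes "0 < \<sigma>" "finite A" "finite K" "k0 \<notin> K" "\<phi> k0 \<in> A"
  shows "mixed_moment \<sigma> A (insert k0 K) \<phi> =
    (\<Sum>k\<in>K. if \<phi> k = \<phi> k0 then \<sigma>\<^sup>2 * mixed_moment \<sigma> A (K - {k}) \<phi> else 0)"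
proof -
  define a where "a = \<phi> k0"
  define c where "c b = card {k \<in> K. \<phi> k = b}" for b
  define P where "P = (\<Prod>b\<in>A - {a}. gauss_moment \<sigma> (c b))"
  have ins: "card {k \<in> insert k0 K. \<phi> k = b} = (if b = a then Suc (c b) else c b)" for b
  proof -
    have "{k \<in> insert k0 K. \<phi> k = b} =
        (if b = a then insert k0 {k \<in> K. \<phi> k = b} else {k \<in> K. \<phi> k = b})"
      by (auto simp: a_def)
    then show ?thesis using assms by (simp add: c_def)
  qed
  have del: "card {k' \<in> K - {k}. \<phi> k' = b} = (if b = a then c b - 1 else c b)"
    if "k \<in> K" "\<phi> k = a" for k b
  proof -
    have "{k' \<in> K - {k}. \<phi> k' = b} = (if b = a then {k' \<in> K. \<phi> k' = b} - {k} else {k' \<in> K. \<phi> k' = b})"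
      using that by auto
    then show ?thesis using assms that by (simp add: c_def)
  qed
  have lhs: "mixed_moment \<sigma> A (insert k0 K) \<phi> = gauss_moment \<sigma> (Suc (c a)) * P"
    unfolding mixed_moment_def ins using assms by (simp add: P_def a_def prod.remove[of A "\<phi> k0"])
  have rhs: "mixed_moment \<sigma> A (K - {k}) \<phi> = gauss_moment \<sigma> (c a - 1) * P"
    if "k \<in> K" "\<phi> k = a" for k
    unfolding mixed_moment_def del[OF that] using assms by (simp add: P_def prod.remove[of A "a"] a_def)
  have "(\<Sum>k\<in>K. if \<phi> k = \<phi> k0 then \<sigma>\<^sup>2 * mixed_moment \<sigma> A (K - {k}) \<phi> else 0)
      = (\<Sum>k\<in>K. if \<phi> k = a then \<sigma>\<^sup>2 * (gauss_moment \<sigma> (c a - 1) * P) else 0)"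
    by (intro sum.cong) (auto simp: rhs a_def)
  also have "\<dots> = real (c a) * (\<sigma>\<^sup>2 * (gauss_moment \<sigma> (c a - 1) * P))"
    using assms(3) by (simp add: c_def flip: sum.inter_filter)
  also have "\<dots> = gauss_moment \<sigma> (Suc (c a)) * P"
    using assms(1) by (cases "c a") (simp_all add: gauss_moment_1 gauss_moment_Suc_Suc)
  finally show ?thesis using lhs by simp
qed

text \<open>
  The expectation of the product of the linear forms $\sum_b c_k(b) X_b$, expanded into monomials:
  \<open>\<phi>\<close> selects the variable taken from each factor.
\<close>
definition form_moment :: "real \<Rightarrow> 'b set \<Rightarrow> 'k set \<Rightarrow> ('k \<Rightarrow> 'b \<Rightarrow> complex) \<Rightarrow> complex" where
  "form_moment \<sigma> A K c =
     (\<Sum>\<phi>\<in>Pi\<^sub>E K (\<lambda>_. A). (\<Prod>k\<in>K. c k (\<phi> k)) * of_real (mixed_moment \<sigma> A K \<phi>))"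

lemma has_bochner_integral_forms:
  assumes "iid_gaussian_moments M \<sigma> A X" "finite A" "finite K"
  shows "has_bochner_integral M (\<lambda>\<omega>. \<Prod>k\<in>K. \<Sum>b\<in>A. c k b * of_real (X b \<omega>)) (form_moment \<sigma> A K c)"
proof -
  have "has_bochner_integral M
     (\<lambda>\<omega>. \<Sum>\<phi>\<in>Pi\<^sub>E K (\<lambda>_. A). (\<Prod>k\<in>K. c k (\<phi> k)) * of_real (\<Prod>k\<in>K. X (\<phi> k) \<omega>)) (form_moment \<sigma> A K c)"
    unfolding form_moment_def
    by (intro has_bochner_integral_sum has_bochner_integral_mult_right
        has_bochner_integral_of_real has_bochner_integral_monomial assms) auto
  then show ?thesis
    using assms by (simp add: prod_sum_PiE prod.distrib)
qed

lemma sum_PiE_insert: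
  assumes "k \<notin> K"
  shows "(\<Sum>\<phi>\<in>Pi\<^sub>E (insert k K) (\<lambda>_. A). g \<phi>) = (\<Sum>b\<in>A. \<Sum>\<phi>\<in>Pi\<^sub>E K (\<lambda>_. A). g (\<phi>(k := b)))"
proof -
  have "inj_on (\<lambda>(y, g). g(k := y)) (A \<times> Pi\<^sub>E K (\<lambda>_. A))"
    using assms by (intro inj_combinator)
  then show ?thesis
    by (simp add: PiE_insert_eq sum.reindex sum.cartesian_product split_def)
qed

lemma mixed_moment_cong:
  "(\<And>k. k \<in> K \<Longrightarrow> \<phi> k = \<psi> k) \<Longrightarrow> mixed_moment \<sigma> A K \<phi> = mixed_moment \<sigma> A K \<psi>"
  unfolding mixed_moment_def by (intro prod.cong arg_cong[where f = "gauss_moment \<sigma>"] arg_cong[where f = card]) auto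

text \<open>
  By multilinearity this reduces to monomials, that is, to \<open>mixed_moment_insert\<close>. For a fixed
  partner \<open>k\<close> of \<open>k0\<close>, summing over the values of \<open>\<phi>\<close> at \<open>k0\<close> and \<open>k\<close>, which are forced to agree,
  produces the covariance of the two forms, and the values at the remaining indices reproduce the
  moment of the remaining forms.
\<close>
lemma wick_recursion:
  assumes "0 < \<sigma>" "finite A" "finite K" "k0 \<notin> K"
  shows "form_moment \<sigma> A (insert k0 K) c =
    (\<Sum>k\<in>K. of_real (\<sigma>\<^sup>2) * (\<Sum>b\<in>A. c k0 b * c k b) * form_moment \<sigma> A (K - {k}) c)"
proof -
  let ?F = "\<lambda>K. Pi\<^sub>E K (\<lambda>_. A)"
  have "form_moment \<sigma> A (insert k0 K) c =
     (\<Sum>\<phi>\<in>?F (insert k0 K). \<Sum>k\<in>K. (\<Prod>j\<in>insert k0 K. c j (\<phi> j)) *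
        (if \<phi> k = \<phi> k0 then of_real (\<sigma>\<^sup>2 * mixed_moment \<sigma> A (K - {k}) \<phi>) else 0))"
    unfolding form_moment_def
    using assms by (intro sum.cong refl)
      (auto simp: mixed_moment_insert sum_distrib_left if_distrib[of of_real] PiE_iff
         intro!: sum.cong cong: if_cong)
  also have "\<dots> = (\<Sum>k\<in>K. \<Sum>\<phi>\<in>?F (insert k0 K). (\<Prod>j\<in>insert k0 K. c j (\<phi> j)) *
        (if \<phi> k = \<phi> k0 then of_real (\<sigma>\<^sup>2 * mixed_moment \<sigma> A (K - {k}) \<phi>) else 0))"
    by (rule sum.swap)
  also have "\<dots> = (\<Sum>k\<in>K. of_real (\<sigma>\<^sup>2) * (\<Sum>b\<in>A. c k0 b * c k b) * form_moment \<sigma> A (K - {k}) c)"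
  proof (intro sum.cong refl)
    fix k assume k: "k \<in> K"
    define K' where "K' = K - {k}"
    have K': "insert k0 K = insert k0 (insert k K')" "k0 \<notin> insert k K'" "k \<notin> K'" "finite K'" "k \<noteq> k0"
      using assms k by (auto simp: K'_def)
    have upd: "mixed_moment \<sigma> A K' (\<phi>(k := b, k0 := b')) = mixed_moment \<sigma> A K' \<phi>"
      "(\<Prod>j\<in>K'. c j ((\<phi>(k := b, k0 := b')) j)) = (\<Prod>j\<in>K'. c j (\<phi> j))" for \<phi> b b'
      using K' by (auto intro!: mixed_moment_cong prod.cong)
    have "(\<Sum>\<phi>\<in>?F (insert k0 K). (\<Prod>j\<in>insert k0 K. c j (\<phi> j)) *
        (if \<phi> k = \<phi> k0 then of_real (\<sigma>\<^sup>2 * mixed_moment \<sigma> A (K - {k}) \<phi>) else 0)) =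
      (\<Sum>b'\<in>A. \<Sum>b\<in>A. \<Sum>\<phi>\<in>?F K'. c k0 b' * c k b * (\<Prod>j\<in>K'. c j (\<phi> j)) *
        (if b = b' then of_real (\<sigma>\<^sup>2 * mixed_moment \<sigma> A K' \<phi>) else 0))"
      unfolding K'_def[symmetric] unfolding K'(1) sum_PiE_insert[OF K'(2)] sum_PiE_insert[OF K'(3)]
      using K' upd by (simp add: mult.assoc cong: if_cong)
    also have "\<dots> = (\<Sum>b'\<in>A. \<Sum>b\<in>A. if b = b' then
        c k0 b' * c k b * of_real (\<sigma>\<^sup>2) * form_moment \<sigma> A K' c else 0)"
      by (intro sum.cong refl) (auto simp: form_moment_def sum_distrib_left algebra_simps)
    also have "\<dots> = of_real (\<sigma>\<^sup>2) * (\<Sum>b\<in>A. c k0 b * c k b) * form_moment \<sigma> A K' c"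
      using assms(2) by (simp add: sum_distrib_left sum_distrib_right algebra_simps)
    finally show "(\<Sum>\<phi>\<in>?F (insert k0 K). (\<Prod>j\<in>insert k0 K. c j (\<phi> j)) *
        (if \<phi> k = \<phi> k0 then of_real (\<sigma>\<^sup>2 * mixed_moment \<sigma> A (K - {k}) \<phi>) else 0)) =
      of_real (\<sigma>\<^sup>2) * (\<Sum>b\<in>A. c k0 b * c k b) * form_moment \<sigma> A (K - {k}) c"
      by (simp add: K'_def)
  qed
  finally show ?thesis .
qed

section \<open>Signed pairings\<close>

text \<open>
  For a set \<open>K\<close> of positive integers these are the pairings of \<open>K\<close> in which every pair carries a
  sign: \<open>\<bar>\<alpha> k\<bar>\<close> is the partner of \<open>k\<close> and the sign of \<open>\<alpha> k\<close> is that of the pair. Oddness extends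
  \<open>\<alpha>\<close> to negative arguments; making it the identity elsewhere makes equality of functions
  the right notion of equality.
\<close>
definition signed_pairings :: "int set \<Rightarrow> (int \<Rightarrow> int) set" where
  "signed_pairings K = {\<alpha>. (\<forall>x. \<bar>x\<bar> \<notin> K \<longrightarrow> \<alpha> x = x) \<and>
     (\<forall>x. \<bar>x\<bar> \<in> K \<longrightarrow> \<bar>\<alpha> x\<bar> \<in> K \<and> \<bar>\<alpha> x\<bar> \<noteq> \<bar>x\<bar> \<and> \<alpha> (\<alpha> x) = x) \<and> (\<forall>x. \<alpha> (- x) = - \<alpha> x)}"

text \<open>
  The condition \<open>\<bar>\<alpha> k\<bar> < k\<close> selects one representative of each pair, so every pair contributes
  one factor.
\<close>
definition pairing_weight ::
  "(int \<Rightarrow> int \<Rightarrow> complex) \<Rightarrow> int set \<Rightarrow> (int \<Rightarrow> int) \<Rightarrow> complex" where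
  "pairing_weight w K \<alpha> = (\<Prod>k\<in>{k \<in> K. \<bar>\<alpha> k\<bar> < k}. w k (\<alpha> k))"

lemma
  assumes "\<alpha> \<in> signed_pairings K"
  shows signed_pairings_odd: "\<alpha> (- x) = - \<alpha> x"
    and signed_pairings_outside: "\<bar>x\<bar> \<notin> K \<Longrightarrow> \<alpha> x = x"
    and signed_pairings_closed: "\<bar>x\<bar> \<in> K \<Longrightarrow> \<bar>\<alpha> x\<bar> \<in> K"
    and signed_pairings_abs_neq: "\<bar>x\<bar> \<in> K \<Longrightarrow> \<bar>\<alpha> x\<bar> \<noteq> \<bar>x\<bar>"
    and signed_pairings_involution: "\<alpha> (\<alpha> x) = x"
  using assms by (cases "\<bar>x\<bar> \<in> K"; simp add: signed_pairings_def)+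

lemma signed_pairings_permutes:
  assumes "\<alpha> \<in> signed_pairings K"
  shows "\<alpha> permutes {x. \<bar>x\<bar> \<in> K}"
  unfolding permutes_def
  using signed_pairings_outside[OF assms] signed_pairings_involution[OF assms] by simp metis

lemma finite_signed_pairings:
  assumes "finite K"
  shows "finite (signed_pairings K)"
proof (rule finite_subset)
  have "{x. \<bar>x\<bar> \<in> K} \<subseteq> K \<union> uminus ` K"
  proof clarify
    fix x assume "\<bar>x\<bar> \<in> K" "x \<notin> uminus ` K"
    then show "x \<in> K" using imageI[of "\<bar>x\<bar>" K uminus] by (cases "0 \<le> x") auto
  qed
  then show "finite {\<alpha>. \<alpha> permutes {x. \<bar>x\<bar> \<in> K}}"
    using assms by (intro finite_permutations) (auto intro: finite_subset)
qed (auto simp: signed_pairings_permutes)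

lemma signed_pairings_empty: "signed_pairings {} = {id}"
  by (auto simp: signed_pairings_def)

text \<open>
  The operations \<open>cut_pair k m\<close> and \<open>add_pair k m\<close> are mutually inverse bijections between the
  signed pairings with \<open>\<alpha> k = m\<close> and the signed pairings of the set without \<open>k\<close> and \<open>\<bar>m\<bar>\<close>.
\<close>
definition cut_pair :: "int \<Rightarrow> int \<Rightarrow> (int \<Rightarrow> int) \<Rightarrow> int \<Rightarrow> int" where
  "cut_pair k m \<alpha> x = (if \<bar>x\<bar> = \<bar>k\<bar> \<or> \<bar>x\<bar> = \<bar>m\<bar> then x else \<alpha> x)"

definition add_pair :: "int \<Rightarrow> int \<Rightarrow> (int \<Rightarrow> int) \<Rightarrow> int \<Rightarrow> int" where
  "add_pair k m \<alpha> x = (if x = k then m else if x = - k then - m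
     else if x = m then k else if x = - m then - k else \<alpha> x)"

lemma cut_pair_signed_pairings:
  assumes "\<alpha> \<in> signed_pairings (insert k K)" "\<alpha> k = m" "0 < k" "k \<notin> K" "K \<subseteq> {1..}"
  shows "cut_pair k m \<alpha> \<in> signed_pairings (K - {\<bar>m\<bar>})"
proof -
  note inv = signed_pairings_involution[OF assms(1)] and neg = signed_pairings_odd[OF assms(1)]
    and fix0 = signed_pairings_outside[OF assms(1)]
    and in1 = signed_pairings_closed[OF assms(1)] signed_pairings_abs_neq[OF assms(1)]
  have m: "\<alpha> m = k" "\<alpha> (- m) = - k" "\<alpha> (- k) = - m" using inv[of k] assms neg by auto
  have k1: "\<bar>\<alpha> x\<bar> = \<bar>k\<bar> \<longleftrightarrow> \<bar>x\<bar> = \<bar>m\<bar>" for x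
    using m assms(2) inv[of x] neg[of x] by (metis abs_eq_iff)
  have m1: "\<bar>\<alpha> x\<bar> = \<bar>m\<bar> \<longleftrightarrow> \<bar>x\<bar> = \<bar>k\<bar>" for x
    using m assms(2) inv[of x] neg[of x] by (metis abs_eq_iff)
  show ?thesis
    unfolding signed_pairings_def mem_Collect_eq
  proof (intro conjI allI impI)
    fix x
    show "cut_pair k m \<alpha> (- x) = - cut_pair k m \<alpha> x" by (simp add: cut_pair_def neg)
    show "cut_pair k m \<alpha> x = x" if "\<bar>x\<bar> \<notin> K - {\<bar>m\<bar>}"
      using that fix0[of x] assms(3) by (auto simp: cut_pair_def)
    assume x: "\<bar>x\<bar> \<in> K - {\<bar>m\<bar>}"
    then have c: "cut_pair k m \<alpha> x = \<alpha> x" "\<bar>x\<bar> \<noteq> \<bar>k\<bar>" "\<bar>x\<bar> \<noteq> \<bar>m\<bar>" using assms by (auto simp: cut_pair_def)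
    then have k2: "\<bar>\<alpha> x\<bar> \<noteq> \<bar>k\<bar>" "\<bar>\<alpha> x\<bar> \<noteq> \<bar>m\<bar>" using k1 m1 by auto
    show "\<bar>cut_pair k m \<alpha> x\<bar> \<in> K - {\<bar>m\<bar>}" "\<bar>cut_pair k m \<alpha> x\<bar> \<noteq> \<bar>x\<bar>"
      using in1[of x] c k2 assms(3) x by auto
    show "cut_pair k m \<alpha> (cut_pair k m \<alpha> x) = x"
      using inv[of x] c k2 by (simp add: cut_pair_def)
  qed
qed

lemma add_pair_signed_pairings:
  assumes "\<alpha> \<in> signed_pairings (K - {\<bar>m\<bar>})" "0 < k" "k \<notin> K" "K \<subseteq> {1..}" "\<bar>m\<bar> \<in> K"
  shows "add_pair k m \<alpha> \<in> signed_pairings (insert k K)"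
proof -
  have m0: "m \<noteq> 0" "\<bar>m\<bar> \<noteq> k" "m \<noteq> k" "m \<noteq> - k" "- m \<noteq> k" using assms by auto
  note neg = signed_pairings_odd[OF assms(1)] and fix0 = signed_pairings_outside[OF assms(1)]
    and in1 = signed_pairings_closed[OF assms(1)] signed_pairings_abs_neq[OF assms(1)]
      signed_pairings_involution[OF assms(1)]
  have off: "add_pair k m \<alpha> x = \<alpha> x" if "\<bar>x\<bar> \<noteq> k" "\<bar>x\<bar> \<noteq> \<bar>m\<bar>" for x
    using that assms by (auto simp: add_pair_def)
  have on: "add_pair k m \<alpha> k = m" "add_pair k m \<alpha> (- k) = - m" "add_pair k m \<alpha> m = k"
    "add_pair k m \<alpha> (- m) = - k"
    using m0 assms(2) by (auto simp: add_pair_def)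
  have cases: "x = k \<or> x = - k \<or> x = m \<or> x = - m \<or> (\<bar>x\<bar> \<noteq> k \<and> \<bar>x\<bar> \<noteq> \<bar>m\<bar>)" for x by arith
  show ?thesis
    unfolding signed_pairings_def mem_Collect_eq
  proof (intro conjI allI impI)
    fix x
    show "add_pair k m \<alpha> (- x) = - add_pair k m \<alpha> x"
      using cases[of x] on off[of x] off[of "- x"] neg by auto
    show "add_pair k m \<alpha> x = x" if "\<bar>x\<bar> \<notin> insert k K"
    proof -
      have "\<bar>x\<bar> \<noteq> k" "\<bar>x\<bar> \<noteq> \<bar>m\<bar>" using that assms(5) by auto
      then show ?thesis using that off[of x] fix0[of x] by auto
    qed
    assume x: "\<bar>x\<bar> \<in> insert k K"
    consider "x = k" | "x = - k" | "x = m" | "x = - m" | "\<bar>x\<bar> \<noteq> k" "\<bar>x\<bar> \<noteq> \<bar>m\<bar>" "\<bar>x\<bar> \<in> K - {\<bar>m\<bar>}"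
      using cases[of x] x by auto
    then have "\<bar>add_pair k m \<alpha> x\<bar> \<in> insert k K \<and> \<bar>add_pair k m \<alpha> x\<bar> \<noteq> \<bar>x\<bar> \<and>
        add_pair k m \<alpha> (add_pair k m \<alpha> x) = x"
    proof cases
      case 5
      have "\<bar>\<alpha> x\<bar> \<noteq> k" "\<bar>\<alpha> x\<bar> \<noteq> \<bar>m\<bar>" using in1(1)[OF 5(3)] assms by auto
      then show ?thesis using in1(1,2)[OF 5(3)] in1(3)[of x] off[OF 5(1,2)] off[of "\<alpha> x"] by auto
    qed (use on assms m0 in auto)
    then show "\<bar>add_pair k m \<alpha> x\<bar> \<in> insert k K" "\<bar>add_pair k m \<alpha> x\<bar> \<noteq> \<bar>x\<bar>"
        "add_pair k m \<alpha> (add_pair k m \<alpha> x) = x" by auto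
  qed
qed

text \<open>
  Since \<open>k\<close> exceeds all elements of \<open>K\<close>, it is the representative of the pair that is added.
\<close>
lemma pairing_weight_add_pair:
  assumes "\<And>x. x \<in> K \<Longrightarrow> x < k" "finite K" "K \<subseteq> {1..}" "\<bar>m\<bar> \<in> K"
  shows "pairing_weight w (insert k K) (add_pair k m \<alpha>) = w k m * pairing_weight w (K - {\<bar>m\<bar>}) \<alpha>"
proof -
  have mk: "0 < \<bar>m\<bar>" "\<bar>m\<bar> < k" using assms(1)[OF assms(4)] assms(3,4) by auto
  have off: "add_pair k m \<alpha> x = \<alpha> x" if "x \<in> K - {\<bar>m\<bar>}" for x
    using that assms(1)[of x] assms(3) by (auto simp: add_pair_def)
  have on: "add_pair k m \<alpha> k = m" "\<bar>add_pair k m \<alpha> \<bar>m\<bar>\<bar> = k"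
    using mk by (auto simp: add_pair_def abs_if)
  have "{x \<in> insert k K. \<bar>add_pair k m \<alpha> x\<bar> < x} = insert k {x \<in> K - {\<bar>m\<bar>}. \<bar>\<alpha> x\<bar> < x}"
  proof (rule set_eqI)
    fix x
    consider "x = k" | "x = \<bar>m\<bar>" | "x \<noteq> k" "x \<noteq> \<bar>m\<bar>" by blast
    then show "x \<in> {x \<in> insert k K. \<bar>add_pair k m \<alpha> x\<bar> < x} \<longleftrightarrow>
        x \<in> insert k {x \<in> K - {\<bar>m\<bar>}. \<bar>\<alpha> x\<bar> < x}"
      by cases (use off[of x] on mk in auto)
  qed
  moreover have "k \<notin> K" using assms(1) by blast
  ultimately show ?thesis
    using assms(2) off on by (simp add: pairing_weight_def)
qed

text \<open>
  The signed pairings are sorted by the value at the new largest index \<open>k\<close>, which is \<open>l\<close> or \<open>- l\<close>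
  for some \<open>l\<close> in \<open>K\<close>; the rest of the pairing is unaffected by which of the two it is.
\<close>
lemma sum_signed_pairings_insert:
  assumes K: "finite K" "K \<subseteq> {1..}" and k: "0 < k" "\<And>x. x \<in> K \<Longrightarrow> x < k"
  shows "(\<Sum>\<alpha>\<in>signed_pairings (insert k K). pairing_weight w (insert k K) \<alpha>) =
    (\<Sum>l\<in>K. (w k l + w k (- l)) * (\<Sum>\<alpha>\<in>signed_pairings (K - {l}). pairing_weight w (K - {l}) \<alpha>))"
proof -
  let ?S = "\<lambda>m. \<Sum>\<alpha>\<in>signed_pairings (K - {\<bar>m\<bar>}). pairing_weight w (K - {\<bar>m\<bar>}) \<alpha>"
  have kK: "k \<notin> K" using k(2) by blast
  have fibre: "(\<Sum>\<alpha>\<in>{\<alpha> \<in> signed_pairings (insert k K). \<alpha> k = m}. pairing_weight w (insert k K) \<alpha>) =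
      w k m * ?S m" if m: "\<bar>m\<bar> \<in> K" for m
    unfolding sum_distrib_left
  proof (rule sum.reindex_bij_witness[where j = "cut_pair k m" and i = "add_pair k m"])
    fix \<alpha> assume "\<alpha> \<in> {\<alpha> \<in> signed_pairings (insert k K). \<alpha> k = m}"
    then have \<alpha>: "\<alpha> \<in> signed_pairings (insert k K)" "\<alpha> k = m" by auto
    have m2: "\<alpha> m = k" "\<alpha> (- m) = - k" "\<alpha> (- k) = - m"
      using signed_pairings_odd[OF \<alpha>(1)] signed_pairings_involution[OF \<alpha>(1), of k] \<alpha>(2) by auto
    show 1: "add_pair k m (cut_pair k m \<alpha>) = \<alpha>"
    proof
      fix x show "add_pair k m (cut_pair k m \<alpha>) x = \<alpha> x"
        using m2 \<alpha>(2) k(1) by (auto simp: add_pair_def cut_pair_def abs_if split: if_splits)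
    qed
    show "cut_pair k m \<alpha> \<in> signed_pairings (K - {\<bar>m\<bar>})"
      using cut_pair_signed_pairings[OF \<alpha> k(1) kK K(2)] .
    show "w k m * pairing_weight w (K - {\<bar>m\<bar>}) (cut_pair k m \<alpha>) = pairing_weight w (insert k K) \<alpha>"
      using pairing_weight_add_pair[of K k m w "cut_pair k m \<alpha>"] k K m by (simp add: 1)
  next
    fix \<alpha> assume \<alpha>: "\<alpha> \<in> signed_pairings (K - {\<bar>m\<bar>})"
    show "add_pair k m \<alpha> \<in> {\<alpha> \<in> signed_pairings (insert k K). \<alpha> k = m}"
      using add_pair_signed_pairings[OF \<alpha> k(1) kK K(2) m] by (simp add: add_pair_def)
    show "cut_pair k m (add_pair k m \<alpha>) = \<alpha>"
    proof
      fix x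
      have "\<alpha> x = x" if "\<bar>x\<bar> = \<bar>k\<bar> \<or> \<bar>x\<bar> = \<bar>m\<bar>"
        using signed_pairings_outside[OF \<alpha>, of x] that kK k(1) by auto
      then show "cut_pair k m (add_pair k m \<alpha>) x = \<alpha> x"
        by (auto simp: add_pair_def cut_pair_def)
    qed
  qed
  have "- x \<notin> K" if "x \<in> K" for x
    using subsetD[OF K(2) that] subsetD[OF K(2), of "- x"] by auto
  then have disj: "K \<inter> uminus ` K = {}" by auto
  have "(\<Sum>\<alpha>\<in>signed_pairings (insert k K). pairing_weight w (insert k K) \<alpha>) =
    (\<Sum>m\<in>K \<union> uminus ` K. \<Sum>\<alpha>\<in>{\<alpha> \<in> signed_pairings (insert k K). \<alpha> k = m}. pairing_weight w (insert k K) \<alpha>)"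
  proof (rule sum.group[symmetric])
    show "(\<lambda>\<alpha>. \<alpha> k) ` signed_pairings (insert k K) \<subseteq> K \<union> uminus ` K"
    proof clarify
      fix \<alpha> assume \<alpha>: "\<alpha> \<in> signed_pairings (insert k K)" "\<alpha> k \<notin> uminus ` K"
      then have "\<bar>\<alpha> k\<bar> \<in> K"
        using signed_pairings_closed[OF \<alpha>(1), of k] signed_pairings_abs_neq[OF \<alpha>(1), of k] k(1)
        by auto
      then show "\<alpha> k \<in> K" using \<alpha>(2) imageI[of "\<bar>\<alpha> k\<bar>" K uminus] by (cases "0 \<le> \<alpha> k") auto
    qed
  qed (use K finite_signed_pairings in auto)
  also have "\<dots> = (\<Sum>m\<in>K \<union> uminus ` K. w k m * ?S m)"
    using K(2) by (intro sum.cong fibre refl) fastforce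
  also have "\<dots> = (\<Sum>m\<in>K. w k m * ?S m) + (\<Sum>m\<in>K. w k (- m) * ?S m)"
    using K(1) disj by (simp add: sum.union_disjoint sum.reindex)
  also have "\<dots> = (\<Sum>m\<in>K. (w k m + w k (- m)) * ?S m)"
    by (simp add: sum.distrib distrib_right)
  also have "\<dots> = (\<Sum>l\<in>K. (w k l + w k (- l)) * (\<Sum>\<alpha>\<in>signed_pairings (K - {l}). pairing_weight w (K - {l}) \<alpha>))"
    using K(2) by (intro sum.cong refl) auto
  finally show ?thesis .
qed

lemma form_moment_empty: "0 < \<sigma> \<Longrightarrow> form_moment \<sigma> A {} c = 1"
  by (simp add: form_moment_def mixed_moment_def gauss_moment_0)

text \<open>
  Wick's rule for covariances that split into two terms: choosing one of the terms for each pair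
  turns the sum over pairings into a sum over signed pairings. The scalar \<open>s\<close> is the normalisation
  of a single form.
\<close>
lemma form_moment_signed_pairings:
  assumes "0 < \<sigma>" "finite A" "finite K" "K \<subseteq> {1..}"
    and "\<And>k l. k \<in> K \<Longrightarrow> l \<in> K \<Longrightarrow>
      of_real (\<sigma>\<^sup>2) * (\<Sum>b\<in>A. c k b * c l b) = s\<^sup>2 * (w k l + w k (- l))"
  shows "form_moment \<sigma> A K c = s ^ card K * (\<Sum>\<alpha>\<in>signed_pairings K. pairing_weight w K \<alpha>)"
  using assms(3-5)
proof (induction K rule: finite_psubset_induct)
  case (psubset K)
  show ?case
  proof (cases "K = {}")
    case True
    then show ?thesis
      using assms(1) by (simp add: form_moment_empty signed_pairings_empty pairing_weight_def)
  next
    case False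
    define k where "k = Max K"
    define K' where "K' = K - {k}"
    have kK: "k \<in> K" using False psubset.hyps by (simp add: k_def)
    then have K: "K = insert k K'" "k \<notin> K'" "finite K'" "K' \<subseteq> {1..}" "0 < k"
      using psubset.hyps psubset.prems(1) by (auto simp: K'_def)
    have lt: "x < k" if "x \<in> K'" for x
      using that psubset.hyps Max_ge[of K x] unfolding K'_def k_def by (auto simp: less_le)
    have card_K: "card K = Suc (Suc (card (K' - {l})))" if "l \<in> K'" for l
      using K that card_Suc_Diff1[of K' l] by simp
    have "form_moment \<sigma> A K c =
        (\<Sum>l\<in>K'. of_real (\<sigma>\<^sup>2) * (\<Sum>b\<in>A. c k b * c l b) * form_moment \<sigma> A (K' - {l}) c)"
      using wick_recursion[OF assms(1,2) K(3,2)] K(1) by simp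
    also have "\<dots> = (\<Sum>l\<in>K'. s ^ card K * ((w k l + w k (- l)) *
        (\<Sum>\<alpha>\<in>signed_pairings (K' - {l}). pairing_weight w (K' - {l}) \<alpha>)))"
    proof (intro sum.cong refl)
      fix l assume l: "l \<in> K'"
      have "form_moment \<sigma> A (K' - {l}) c = s ^ card (K' - {l}) *
          (\<Sum>\<alpha>\<in>signed_pairings (K' - {l}). pairing_weight w (K' - {l}) \<alpha>)"
        using psubset.prems K l by (intro psubset.IH) auto
      moreover have "of_real (\<sigma>\<^sup>2) * (\<Sum>b\<in>A. c k b * c l b) = s\<^sup>2 * (w k l + w k (- l))"
        using psubset.prems(2)[OF kK] l K(1) by auto
      ultimately show "of_real (\<sigma>\<^sup>2) * (\<Sum>b\<in>A. c k b * c l b) * form_moment \<sigma> A (K' - {l}) c =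
          s ^ card K * ((w k l + w k (- l)) *
            (\<Sum>\<alpha>\<in>signed_pairings (K' - {l}). pairing_weight w (K' - {l}) \<alpha>))"
        unfolding card_K[OF l] by (simp add: power2_eq_square)
    qed
    also have "\<dots> = s ^ card K * (\<Sum>\<alpha>\<in>signed_pairings K. pairing_weight w K \<alpha>)"
      using sum_signed_pairings_insert[OF K(3,4,5) lt, of w] K(1)
      by (simp add: sum_distrib_left)
    finally show ?thesis .
  qed
qed

section \<open>Entries of the Gaussian symplectic ensemble\<close>

fun quat_comp :: "nat \<Rightarrow> quat \<Rightarrow> real" where
  "quat_comp l (a, b, c, d) = (if l = 0 then a else if l = 1 then b else if l = 2 then c else d)"

text \<open>
  The entry \<open>(r, s)\<close> of the complex matrix of the \<open>l\<close>-th basis quaternion among $1, i, j, k$.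
\<close>
definition quat_coeff :: "nat \<Rightarrow> int \<Rightarrow> int \<Rightarrow> complex" where
  "quat_coeff l r s = quat_entry
     (if l = 0 then (1, 0, 0, 0) else if l = 1 then (0, 1, 0, 0)
      else if l = 2 then (0, 0, 1, 0) else (0, 0, 0, 1)) r s"

definition cnj_sign :: "nat \<Rightarrow> real" where
  "cnj_sign l = (if l = 0 then 1 else - 1)"

lemma atLeastAtMost_0_3: "{0..3} = {0, 1, 2, 3::nat}"
  by auto

lemma quat_coeff_table:
  "quat_coeff 0 1 1 = 1" "quat_coeff 0 1 (- 1) = 0" "quat_coeff 0 (- 1) 1 = 0" "quat_coeff 0 (- 1) (- 1) = 1"
  "quat_coeff 1 1 1 = \<i>" "quat_coeff 1 1 (- 1) = 0" "quat_coeff 1 (- 1) 1 = 0" "quat_coeff 1 (- 1) (- 1) = - \<i>"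
  "quat_coeff 2 1 1 = 0" "quat_coeff 2 1 (- 1) = 1" "quat_coeff 2 (- 1) 1 = - 1" "quat_coeff 2 (- 1) (- 1) = 0"
  "quat_coeff 3 1 1 = 0" "quat_coeff 3 1 (- 1) = \<i>" "quat_coeff 3 (- 1) 1 = \<i>" "quat_coeff 3 (- 1) (- 1) = 0"
  by (simp_all add: quat_coeff_def Complex_eq)

lemma quat_entry_sum:
  "quat_entry q r s = (\<Sum>l\<in>{0..3}. quat_coeff l r s * of_real (quat_comp l q))"
proof -
  obtain a b c d where q: "q = (a, b, c, d)" by (cases q)
  consider "r = 1" "s = 1" | "r = 1" "s = - 1" | "r = - 1" "s = 1" | "r = - 1" "s = - 1"
    | "\<not> (r \<in> {1, - 1} \<and> s \<in> {1, - 1})" by auto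
  then show ?thesis
  proof cases
    case 5
    then have "quat_entry p r s = 0" for p by (cases p) auto
    then show ?thesis by (simp add: quat_coeff_def)
  qed (simp_all add: q atLeastAtMost_0_3 quat_coeff_table[unfolded One_nat_def] Complex_eq algebra_simps)
qed

lemma quat_comp_cnj: "quat_comp l (quat_cnj q) = cnj_sign l * quat_comp l q"
  by (cases q) (simp add: cnj_sign_def)

lemma quat_comp_linear:
  "quat_comp l (p + q) = quat_comp l p + quat_comp l q"
  "quat_comp l (t *\<^sub>R q) = t * quat_comp l q"
  by (cases p, cases q, simp) (cases q, simp)

lemma borel_measurable_quat_comp: "quat_comp l \<in> borel_measurable borel"
proof -
  have "continuous_on UNIV (quat_comp l)"
  proof -
    consider "l = 0" | "l = 1" | "l = 2" | "l \<notin> {0, 1, 2}" by auto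
    then show ?thesis
    proof cases
      case 1
      then have "quat_comp l = fst" by auto
      then show ?thesis by (simp add: continuous_on_fst continuous_on_snd continuous_on_id)
    next
      case 2
      then have "quat_comp l = (\<lambda>q. fst (snd q))" by auto
      then show ?thesis by (simp add: continuous_on_fst continuous_on_snd continuous_on_id)
    next
      case 3
      then have "quat_comp l = (\<lambda>q. fst (snd (snd q)))" by auto
      then show ?thesis by (simp add: continuous_on_fst continuous_on_snd continuous_on_id)
    next
      case 4
      then have "quat_comp l = (\<lambda>q. snd (snd (snd q)))" by auto
      then show ?thesis by (simp add: continuous_on_fst continuous_on_snd continuous_on_id)
    qed
  qed
  then show ?thesis by (rule borel_measurable_continuous_onI)
qed

lemma (in prob_space) std_quat_gaussian_moments:
  assumes "std_quat_gaussian M X"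
  shows "iid_gaussian_moments M (1 / 2) {0..3} (\<lambda>l \<omega>. quat_comp l (X \<omega>))"
proof -
  obtain \<xi> :: "nat \<Rightarrow> 'a \<Rightarrow> real" where \<xi>: "indep_vars (\<lambda>_. borel) \<xi> {0..3}"
    "\<And>l. l \<in> {0..3} \<Longrightarrow> distributed M lborel (\<xi> l) (normal_density 0 (1/2))"
    "\<And>\<omega>. \<omega> \<in> space M \<Longrightarrow> X \<omega> = (\<xi> 0 \<omega>, \<xi> 1 \<omega>, \<xi> 2 \<omega>, \<xi> 3 \<omega>)"
    using assms unfolding std_quat_gaussian_def by blast
  have "iid_gaussian_moments M (1 / 2) {0..3} \<xi>"
    by (rule iid_gaussian_moments_indep) (use \<xi> in auto)
  moreover have "(\<Prod>l\<in>{0..3}. quat_comp l (X \<omega>) ^ m l) = (\<Prod>l\<in>{0..3}. \<xi> l \<omega> ^ m l)"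
    if "\<omega> \<in> space M" for \<omega> m
    using \<xi>(3)[OF that] by (simp add: atLeastAtMost_0_3)
  ultimately show ?thesis
    unfolding iid_gaussian_moments_def by (simp cong: has_bochner_integral_cong)
qed

text \<open>
  The coefficient of the \<open>l\<close>-th coordinate of \<open>G\<close> at position \<open>p\<close> in the \<open>(r, s)\<close> entry of the
  quaternion at position \<open>x\<close> of the ensemble. On the diagonal both indicators fire, and the
  imaginary coordinates cancel.
\<close>
definition gse_coeff :: "nat \<Rightarrow> nat \<times> nat \<Rightarrow> int \<Rightarrow> int \<Rightarrow> (nat \<times> nat) \<times> nat \<Rightarrow> complex" where
  "gse_coeff N x r s = (\<lambda>(p, l). of_real (1 / sqrt (2 * real N)) * quat_coeff l r s *
     (of_bool (p = x) + of_real (cnj_sign l) * of_bool (p = prod.swap x)))"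

lemma sum_two_deltas:
  fixes h :: "'b \<Rightarrow> complex"
  assumes "finite I" "x \<in> I" "y \<in> I"
  shows "(\<Sum>p\<in>I. (of_bool (p = x) + e * of_bool (p = y)) * h p) = h x + e * h y"
proof -
  have "(\<Sum>p\<in>I. (of_bool (p = x) + e * of_bool (p = y)) * h p) =
      (\<Sum>p\<in>I. if p = x then h p else 0) + (\<Sum>p\<in>I. if p = y then e * h p else 0)"
    unfolding sum.distrib[symmetric] by (intro sum.cong refl) (simp add: distrib_right)
  then show ?thesis using assms by simp
qed

lemma gse_entry_sum:
  assumes "i \<in> {1..N}" "j \<in> {1..N}"
    and T: "T = (1 / sqrt (2 * real N)) *\<^sub>R (g (i, j) + quat_cnj (g (j, i)))"
  shows "quat_entry T r s =
    (\<Sum>b\<in>({1..N} \<times> {1..N}) \<times> {0..3}. gse_coeff N (i, j) r s b * of_real (quat_comp (snd b) (g (fst b))))"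
proof -
  define t where "t = 1 / sqrt (2 * real N)"
  have "(\<Sum>b\<in>({1..N} \<times> {1..N}) \<times> {0..3}. gse_coeff N (i, j) r s b * of_real (quat_comp (snd b) (g (fst b))))
    = (\<Sum>l\<in>{0..3}. \<Sum>p\<in>{1..N} \<times> {1..N}. gse_coeff N (i, j) r s (p, l) * of_real (quat_comp l (g p)))"
    by (subst sum.cartesian_product') (simp only: fst_conv snd_conv, rule sum.swap)
  also have "\<dots> = (\<Sum>l\<in>{0..3}. quat_coeff l r s * of_real (quat_comp l T))"
  proof (intro sum.cong refl)
    fix l :: nat
    have "(\<Sum>p\<in>{1..N} \<times> {1..N}. gse_coeff N (i, j) r s (p, l) * of_real (quat_comp l (g p))) =
      of_real t * quat_coeff l r s * (\<Sum>p\<in>{1..N} \<times> {1..N}.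
        (of_bool (p = (i, j)) + of_real (cnj_sign l) * of_bool (p = (j, i))) * of_real (quat_comp l (g p)))"
      by (simp add: gse_coeff_def t_def sum_distrib_left mult.assoc)
    also have "\<dots> = quat_coeff l r s * of_real (quat_comp l T)"
      unfolding T t_def[symmetric] using assms(1,2)
      by (subst sum_two_deltas) (simp_all add: quat_comp_linear quat_comp_cnj)
    finally show "(\<Sum>p\<in>{1..N} \<times> {1..N}. gse_coeff N (i, j) r s (p, l) * of_real (quat_comp l (g p))) =
      quat_coeff l r s * of_real (quat_comp l T)" .
  qed
  finally show ?thesis by (simp only: quat_entry_sum)
qed

text \<open>
  Multiplied by the variance $\frac14$ of the coordinates, these are the second moments of the
  matrix of a standard Gaussian quaternion $g$: of an entry of $g$ with an entry of $g$, and of an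
  entry of $g$ with an entry of its conjugate transpose.
\<close>
lemma quat_coeff_contractions:
  assumes "r \<in> {1, -1}" "s \<in> {1, -1}" "r' \<in> {1, -1}" "s' \<in> {1, -1}"
  shows "(\<Sum>l\<in>{0..3}. quat_coeff l r s * quat_coeff l r' s') =
      (if r = - r' \<and> s = - s' then 2 * of_int (r * s) else 0)"
    and "(\<Sum>l\<in>{0..3}. of_real (cnj_sign l) * (quat_coeff l r s * quat_coeff l r' s')) =
      (if r = s' \<and> s = r' then 2 else 0)"
  using assms
  by (elim insertE emptyE;
      simp add: atLeastAtMost_0_3 quat_coeff_table[unfolded One_nat_def] cnj_sign_def)+

text \<open>
  With $T = \frac1{\sqrt{2N}}(G+G^*)$, the two products of unlike terms give the first indicator and
  the two products of like terms the second one. Each occurs twice; the resulting factor 2,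
  the factor 2 in the contractions and the variance $\frac14$ cancel. The formula includes diagonal
  entries, where both indicators may be nonzero.
\<close>
lemma gse_covariance:
  assumes x: "x \<in> {1..N} \<times> {1..N}" and y: "y \<in> {1..N} \<times> {1..N}"
    and rs: "r \<in> {1, -1}" "s \<in> {1, -1}" "r' \<in> {1, -1}" "s' \<in> {1, -1}"
  shows "of_real ((1 / 2)\<^sup>2) *
      (\<Sum>b\<in>({1..N} \<times> {1..N}) \<times> {0..3}. gse_coeff N x r s b * gse_coeff N y r' s' b) =
    (of_real (1 / sqrt (2 * real N)))\<^sup>2 *
      ((if x = prod.swap y \<and> r = s' \<and> s = r' then 1 else 0) +
       (if x = y \<and> r = - r' \<and> s = - s' then of_int (r * s) else 0))"
proof -
  define I where "I = {1..N} \<times> {1..N}"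
  define t where "t = complex_of_real (1 / sqrt (2 * real N))"
  define e where "e l = complex_of_real (cnj_sign l)" for l
  define D where "D l x p = of_bool (p = x) + e l * of_bool (p = prod.swap x)" for l and x p :: "nat \<times> nat"
  define q where "q l = quat_coeff l r s * quat_coeff l r' s'" for l
  have expand: "(a + z * b) + z * (b + z * a) = (1 + z * z) * a + 2 * z * b" for a b z :: complex
    by (simp add: algebra_simps)
  have collect: "complex_of_real ((1 / 2)\<^sup>2) *
        (2 * u * of_bool a * (if P then 2 * v else 0) + 2 * u * of_bool b * (if Q then 2 else 0)) =
      u * ((if b \<and> Q then 1 else 0) + (if a \<and> P then v else 0))" for a b P Q u v
    by (cases a; cases b; cases P; cases Q; simp add: power2_eq_square algebra_simps)
  have sq: "e l * e l = 1" for l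
    by (simp add: cnj_sign_def e_def)
  have I: "finite I" "x \<in> I" "prod.swap x \<in> I"
    using x by (auto simp: I_def)
  have sw: "prod.swap x = y \<longleftrightarrow> x = prod.swap y" "prod.swap x = prod.swap y \<longleftrightarrow> x = y"
    by (cases x, cases y, auto)+
  have D: "(\<Sum>p\<in>I. D l x p * D l y p) = 2 * (of_bool (x = y) + e l * of_bool (x = prod.swap y))" for l
  proof -
    have "(\<Sum>p\<in>I. D l x p * D l y p) = D l y x + e l * D l y (prod.swap x)"
      unfolding D_def[of l x] by (rule sum_two_deltas[OF I])
    also have "\<dots> = (1 + e l * e l) * of_bool (x = y) + 2 * e l * of_bool (x = prod.swap y)"
      unfolding D_def sw by (rule expand)
    finally show ?thesis by (simp add: sq distrib_left)
  qed
  have "(\<Sum>b\<in>I \<times> {0..3}. gse_coeff N x r s b * gse_coeff N y r' s' b) =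
      (\<Sum>p\<in>I. \<Sum>l\<in>{0..3}. t\<^sup>2 * q l * (D l x p * D l y p))"
    unfolding sum.cartesian_product gse_coeff_def t_def[symmetric] e_def[symmetric]
    by (intro sum.cong refl) (simp add: split_def D_def[symmetric] q_def power2_eq_square mult_ac)
  also have "\<dots> = (\<Sum>l\<in>{0..3}. t\<^sup>2 * q l * (\<Sum>p\<in>I. D l x p * D l y p))"
    unfolding sum_distrib_left by (rule sum.swap)
  also have "\<dots> = (\<Sum>l\<in>{0..3}. 2 * t\<^sup>2 * of_bool (x = y) * q l) +
      (\<Sum>l\<in>{0..3}. 2 * t\<^sup>2 * of_bool (x = prod.swap y) * (e l * q l))"
    unfolding D sum.distrib[symmetric] by (intro sum.cong refl) (simp only: distrib_left mult_ac)
  also have "\<dots> = 2 * t\<^sup>2 * of_bool (x = y) * (\<Sum>l\<in>{0..3}. q l) +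
      2 * t\<^sup>2 * of_bool (x = prod.swap y) * (\<Sum>l\<in>{0..3}. e l * q l)"
    by (simp only: sum_distrib_left)
  finally show ?thesis
    unfolding I_def[symmetric] t_def[symmetric]
    by (simp only: q_def e_def quat_coeff_contractions[OF rs]) (rule collect)
qed

section \<open>Signed pairings as permutations of plus or minus the first n integers\<close>

lemma orbit_involution:
  assumes "\<alpha> (\<alpha> x) = x"
  shows "orbit \<alpha> x = {x, \<alpha> x}"
proof
  show "orbit \<alpha> x \<subseteq> {x, \<alpha> x}"
  proof
    fix y assume "y \<in> orbit \<alpha> x"
    then show "y \<in> {x, \<alpha> x}" by induction (use assms in auto)
  qed
  show "{x, \<alpha> x} \<subseteq> orbit \<alpha> x"
    using orbit.base[of \<alpha> x] orbit.step[OF orbit.base, of \<alpha> x] assms by simp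
qed

lemma pm_iff: "x \<in> pm n \<longleftrightarrow> \<bar>x\<bar> \<in> {1..int n}"
proof -
  have "x \<in> uminus ` {1..int n} \<longleftrightarrow> - x \<in> {1..int n}" by (metis image_iff minus_minus)
  then show ?thesis unfolding pm_def by auto
qed

text \<open>
  All cycles of a pairing have length two, so it is its own inverse; the relation
  $\delta\pi\delta = \pi^{-1}$ then says that it is odd, and the separation of \<open>k\<close> from \<open>- k\<close> says
  that it does not map \<open>k\<close> to \<open>- k\<close>.
\<close>
lemma PM_pairings_eq: "PM n \<inter> pairings (pm n) = signed_pairings {1..int n}"
proof (intro equalityI subsetI)
  fix \<alpha> assume \<alpha>: "\<alpha> \<in> PM n \<inter> pairings (pm n)"
  then have perm: "\<alpha> permutes pm n" and neg: "uminus \<circ> \<alpha> \<circ> uminus = inv \<alpha>"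
    and no: "\<And>k. k \<in> pm n \<Longrightarrow> - k \<notin> orbit \<alpha> k" and two: "\<And>k. k \<in> pm n \<Longrightarrow> card (orbit \<alpha> k) = 2"
    by (auto simp: PM_def pairings_def)
  have "finite (pm n)" by (simp add: pm_def)
  then have "permutation \<alpha>" using perm permutation_permutes by blast
  then have self: "x \<in> orbit \<alpha> x" for x by (rule permutation_self_in_orbit)
  have orb: "\<alpha> x \<noteq> x \<and> \<alpha> (\<alpha> x) = x" if "x \<in> pm n" for x
  proof -
    have ne: "\<alpha> x \<noteq> x" using two[OF that] orbit_eq_singleton_iff[of \<alpha> x] by auto
    have "{x, \<alpha> x} = orbit \<alpha> x"
      using two[OF that] self[of x] ne orbit.base[of \<alpha> x]
      by (intro card_subset_eq card_ge_0_finite) auto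
    then have "\<alpha> (\<alpha> x) \<in> {x, \<alpha> x}" using orbit.step[OF orbit.base, of \<alpha> x] by simp
    then show ?thesis using ne permutes_inj[OF perm] by (auto dest: injD)
  qed
  have fix0: "\<alpha> x = x" if "x \<notin> pm n" for x using perm that by (rule permutes_not_in)
  have inv: "\<alpha> (\<alpha> x) = x" for x using orb fix0 by (cases "x \<in> pm n") auto
  then have "inv \<alpha> = \<alpha>" by (intro inv_unique_comp ext) auto
  then have "- \<alpha> (- x) = \<alpha> x" for x using fun_cong[OF neg, of x] by simp
  then have odd: "\<alpha> (- x) = - \<alpha> x" for x by (metis minus_minus)
  have "\<bar>\<alpha> x\<bar> \<noteq> \<bar>x\<bar>" if "x \<in> pm n" for x
    using orb[OF that] no[OF that] orbit.base[of \<alpha> x] by (auto simp: abs_eq_iff)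
  then show "\<alpha> \<in> signed_pairings {1..int n}"
    using inv odd fix0 permutes_in_image[OF perm] unfolding signed_pairings_def pm_iff by simp
next
  fix \<alpha> assume \<alpha>: "\<alpha> \<in> signed_pairings {1..int n}"
  then have perm: "\<alpha> permutes pm n"
    using signed_pairings_permutes[OF \<alpha>] by (simp only: pm_iff[symmetric] Collect_mem_eq)
  note inv = signed_pairings_involution[OF \<alpha>] and odd = signed_pairings_odd[OF \<alpha>]
    and abs = signed_pairings_abs_neq[OF \<alpha>, folded pm_iff]
  have "inv \<alpha> = \<alpha>" using inv by (intro inv_unique_comp ext) auto
  moreover have "- x \<notin> orbit \<alpha> x" "card (orbit \<alpha> x) = 2" if "x \<in> pm n" for x
  proof -
    have "x \<noteq> 0" using that by (auto simp: pm_iff)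
    then show "- x \<notin> orbit \<alpha> x" "card (orbit \<alpha> x) = 2"
      using abs[OF that] unfolding orbit_involution[of \<alpha>, OF inv] by (auto simp: card_insert_if)
  qed
  ultimately show "\<alpha> \<in> PM n \<inter> pairings (pm n)"
    using perm odd by (auto simp: PM_def pairings_def fun_eq_iff)
qed

lemma num_orbits_pairing:
  assumes "\<alpha> \<in> signed_pairings {1..int n}"
  shows "num_orbits n \<alpha> = n"
proof -
  note inv = signed_pairings_involution[OF assms]
  have "\<alpha> \<in> pairings (pm n)" using assms PM_pairings_eq by blast
  then have two: "\<And>k. k \<in> pm n \<Longrightarrow> card (orbit \<alpha> k) = 2" and perm: "\<alpha> permutes pm n"
    by (auto simp: pairings_def)
  note orb = orbit_involution[of \<alpha>, OF inv]
  have un: "\<Union> (orbit \<alpha> ` pm n) = pm n"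
    using permutes_in_image[OF perm] by (auto simp: orb)
  have fin: "finite (pm n)" by (simp add: pm_def)
  have "2 * card (orbit \<alpha> ` pm n) = card (\<Union> (orbit \<alpha> ` pm n))"
  proof (rule card_partition)
    fix c1 c2 assume "c1 \<in> orbit \<alpha> ` pm n" "c2 \<in> orbit \<alpha> ` pm n" "c1 \<noteq> c2"
    then show "c1 \<inter> c2 = {}" using inv by (auto simp: orb) metis+
  qed (use fin un two in auto)
  moreover have "{1..int n} \<inter> uminus ` {1..int n} = {}" by auto
  then have "card (pm n) = 2 * n" unfolding pm_def by (simp add: card_Un_disjoint card_image)
  ultimately show ?thesis by (simp add: num_orbits_def un)
qed

text \<open>
  The cycle of \<open>- k\<close> consists of \<open>- k\<close> and \<open>- \<alpha> k\<close>. Its element of smallest absolute value is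
  positive only if that element is \<open>- \<alpha> k\<close>. So the product over \<open>FD\<close> has one factor for each
  pair with a negative sign, taken at the larger index of the pair.
\<close>
lemma FD_pairing_iff:
  assumes "\<alpha> \<in> signed_pairings {1..int n}" "k \<in> {1..int n}"
  shows "- k \<in> FD n \<alpha> \<longleftrightarrow> \<bar>\<alpha> k\<bar> < k \<and> \<alpha> k < 0"
proof -
  have a: "\<alpha> (\<alpha> k) = k" "\<alpha> (- k) = - \<alpha> k" "\<bar>\<alpha> k\<bar> \<noteq> \<bar>k\<bar>" "\<alpha> (\<alpha> (- k)) = - k"
    using assms(2) signed_pairings_involution[OF assms(1)] signed_pairings_odd[OF assms(1)]
      signed_pairings_abs_neq[OF assms(1), of k] by auto
  show ?thesis
    using assms(2) a(3) unfolding FD_def mem_Collect_eq orbit_involution[of \<alpha>, OF a(4)] a(2)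
    by (auto simp: pm_iff)
qed

text \<open>
  The two terms of the covariance, without the normalisation $\frac1{2N}$: for positive \<open>m\<close> the term
  matching rows with columns, for negative \<open>m\<close> the term matching rows with rows. The sign of \<open>m\<close>
  accounts for the difference between the conditions on \<open>\<eta>\<close>.
\<close>
definition gse_pair_weight :: "(int \<Rightarrow> nat) \<Rightarrow> (int \<Rightarrow> int) \<Rightarrow> int \<Rightarrow> int \<Rightarrow> complex" where
  "gse_pair_weight \<iota> \<eta> k m =
     (if \<iota> k = \<iota> (- m) \<and> \<iota> (- k) = \<iota> m \<and> \<eta> k = sgn m * \<eta> (- m) \<and> \<eta> (- k) = sgn m * \<eta> m
      then if m < 0 then of_int (\<eta> k * \<eta> (- k)) else 1 else 0)"

text \<open>
  The condition at \<open>x\<close> is the one at \<open>- \<alpha> x\<close> read backwards. Hence the two conditions at \<open>k\<close> and \<open>- k\<close>, for the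
  larger index \<open>k\<close> of each pair, imply those at all four points of the orbits of \<open>k\<close> and \<open>- k\<close>.
\<close>
lemma compatible_iff_half:
  assumes "\<alpha> \<in> signed_pairings {1..int n}"
  shows "((\<forall>k\<in>pm n. \<iota> k = \<iota> (- \<alpha> k)) \<and> (\<forall>k\<in>pm n. sgn k * \<eta> k = sgn (\<alpha> k) * \<eta> (- \<alpha> k))) \<longleftrightarrow>
    (\<forall>k\<in>{k \<in> {1..int n}. \<bar>\<alpha> k\<bar> < k}. \<iota> k = \<iota> (- \<alpha> k) \<and> \<iota> (- k) = \<iota> (\<alpha> k) \<and>
       \<eta> k = sgn (\<alpha> k) * \<eta> (- \<alpha> k) \<and> \<eta> (- k) = sgn (\<alpha> k) * \<eta> (\<alpha> k))"
    (is "?full \<longleftrightarrow> ?half")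
proof
  note odd = signed_pairings_odd[OF assms]
  have sgn_neg: "sgn (- x) = - sgn x" for x :: int by (simp add: sgn_if)
  {
    assume ?full
    show ?half
    proof clarify
      fix k assume k: "k \<in> {1..int n}" "\<bar>\<alpha> k\<bar> < k"
      then have "k \<in> pm n" "- k \<in> pm n" by (auto simp: pm_iff)
      with \<open>?full\<close> have "\<iota> k = \<iota> (- \<alpha> k)" "sgn k * \<eta> k = sgn (\<alpha> k) * \<eta> (- \<alpha> k)"
        "\<iota> (- k) = \<iota> (- \<alpha> (- k))" "sgn (- k) * \<eta> (- k) = sgn (\<alpha> (- k)) * \<eta> (- \<alpha> (- k))"
        by blast+
      then show "\<iota> k = \<iota> (- \<alpha> k) \<and> \<iota> (- k) = \<iota> (\<alpha> k) \<and>
         \<eta> k = sgn (\<alpha> k) * \<eta> (- \<alpha> k) \<and> \<eta> (- k) = sgn (\<alpha> k) * \<eta> (\<alpha> k)"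
        using k by (simp add: odd sgn_neg)
    qed
  }
  {
    assume half: ?half
    have "\<iota> x = \<iota> (- \<alpha> x) \<and> sgn x * \<eta> x = sgn (\<alpha> x) * \<eta> (- \<alpha> x)" if x: "x \<in> pm n" for x
    proof -
      have X: "\<alpha> (\<alpha> x) = x" "\<bar>\<alpha> x\<bar> \<noteq> \<bar>x\<bar>" "\<bar>\<alpha> x\<bar> \<in> {1..int n}" "\<bar>x\<bar> \<in> {1..int n}"
        using x signed_pairings_involution[OF assms] signed_pairings_abs_neq[OF assms]
          signed_pairings_closed[OF assms] unfolding pm_iff by blast+
      \<comment> \<open>the larger index of the pair of x, at which the hypothesis applies\<close>
      define k where "k = max \<bar>x\<bar> \<bar>\<alpha> x\<bar>"
      have cases: "x = k \<or> x = - k \<or> x = \<alpha> k \<or> x = - \<alpha> k"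
        using odd[of "\<alpha> x"] X(1) by (auto simp: k_def max_def abs_if)
      have k: "\<bar>\<alpha> k\<bar> < k" "k \<in> {1..int n}"
        using X odd[of x] odd[of "\<alpha> x"] by (auto simp: k_def max_def abs_if)
      then have h: "\<iota> k = \<iota> (- \<alpha> k)" "\<iota> (- k) = \<iota> (\<alpha> k)"
        "\<eta> k = sgn (\<alpha> k) * \<eta> (- \<alpha> k)" "\<eta> (- k) = sgn (\<alpha> k) * \<eta> (\<alpha> k)"
        using half by blast+
      have sgn_k: "sgn k = 1" using k(2) by simp
      note inv = signed_pairings_involution[OF assms]
      from cases show ?thesis
        by (elim disjE) (simp_all add: odd inv sgn_neg sgn_k h)
    qed
    then show ?full by blast
  }
qed

lemma prod_if_all:
  "finite S \<Longrightarrow> (\<Prod>k\<in>S. if P k then g k else 0) = (if \<forall>k\<in>S. P k then \<Prod>k\<in>S. g k else (0::complex))"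
  by (auto intro: prod_zero)

text \<open>
  A product of pair weights vanishes unless all conditions hold, and then only the pairs with a
  negative sign contribute a factor different from 1.
\<close>
lemma pairing_weight_gse:
  assumes "\<alpha> \<in> signed_pairings {1..int n}"
  shows "pairing_weight (gse_pair_weight \<iota> \<eta>) {1..int n} \<alpha> =
    (if (\<forall>k\<in>pm n. \<iota> k = \<iota> (- \<alpha> k)) \<and> (\<forall>k\<in>pm n. sgn k * \<eta> k = sgn (\<alpha> k) * \<eta> (- \<alpha> k))
     then of_int (\<Prod>k\<in>{k \<in> {1..int n}. -k \<in> FD n \<alpha>}. \<eta> k * \<eta> (-k)) else 0)"
proof -
  let ?S = "{k \<in> {1..int n}. \<bar>\<alpha> k\<bar> < k}"
  have fin: "finite ?S" by (rule finite_subset[of _ "{1..int n}"]) auto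
  have "(\<Prod>k\<in>?S. if \<alpha> k < 0 then complex_of_int (\<eta> k * \<eta> (- k)) else 1) =
     (\<Prod>k\<in>{k \<in> ?S. \<alpha> k < 0}. complex_of_int (\<eta> k * \<eta> (- k)))"
    by (rule prod.inter_filter[OF fin, symmetric])
  also have "{k \<in> ?S. \<alpha> k < 0} = {k \<in> {1..int n}. - k \<in> FD n \<alpha>}"
    using FD_pairing_iff[OF assms] by auto
  finally show ?thesis
    unfolding pairing_weight_def gse_pair_weight_def compatible_iff_half[OF assms]
    using fin by (subst prod_if_all) auto
qed

lemma gse_pair_weight_sum:
  assumes "0 < l"
  shows "gse_pair_weight \<iota> \<eta> k l + gse_pair_weight \<iota> \<eta> k (- l) =
    (if (\<iota> k, \<iota> (- k)) = prod.swap (\<iota> l, \<iota> (- l)) \<and> \<eta> k = \<eta> (- l) \<and> \<eta> (- k) = \<eta> l then 1 else 0) +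
    (if (\<iota> k, \<iota> (- k)) = (\<iota> l, \<iota> (- l)) \<and> \<eta> k = - \<eta> l \<and> \<eta> (- k) = - \<eta> (- l)
     then of_int (\<eta> k * \<eta> (- k)) else 0)"
proof -
  have "sgn l = 1" "sgn (- l) = - 1" "\<not> l < 0" "- l < 0" using assms by auto
  then show ?thesis
    unfolding gse_pair_weight_def
    by (simp only: minus_minus mult_1 mult_minus1 swap_simp prod.inject if_True if_False conj_assoc)
qed

section \<open>The moments of the ensemble\<close>

lemma powr_half_minus:
  fixes x :: real
  assumes "0 < x"
  shows "x powr (real n / 2 - real n) = (1 / sqrt x) ^ n"
proof -
  have half: "x powr - (1 / 2) = 1 / sqrt x"
    unfolding powr_minus_divide using assms by (simp add: powr_half_sqrt)
  have "x powr (real n / 2 - real n) = x powr (- (1 / 2) * real n)"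
    by (intro arg_cong2[where f = "(powr)"]) auto
  also have "\<dots> = (1 / sqrt x) powr real n"
    unfolding half[symmetric] by (rule powr_powr[symmetric])
  also have "\<dots> = (1 / sqrt x) ^ n"
    using assms by (intro powr_realpow) simp
  finally show ?thesis .
qed

lemma sum_PM_f_GSE:
  "(\<Sum>\<alpha>\<in>{\<alpha> \<in> PM n. C \<alpha>}. g \<alpha> * f_GSE n \<alpha>) = (\<Sum>\<alpha>\<in>{\<alpha> \<in> signed_pairings {1..int n}. C \<alpha>}. g \<alpha>)"
proof (rule sum.mono_neutral_cong_right)
  have "finite {\<alpha>. \<alpha> permutes pm n}" by (intro finite_permutations) (simp add: pm_def)
  then show "finite {\<alpha> \<in> PM n. C \<alpha>}" by (rule finite_subset[rotated]) (auto simp: PM_def)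
qed (auto simp: f_GSE_def PM_pairings_eq[symmetric])

theorem proposition5p7:
  fixes M :: "'a measure" and N n :: nat
    and T :: "nat \<Rightarrow> nat \<Rightarrow> 'a \<Rightarrow> quat"
    and \<iota> :: "int \<Rightarrow> nat" and \<eta> :: "int \<Rightarrow> int"
  assumes "prob_space M"
    and "is_GSE M N T"
    and "n \<ge> 1"
    and "\<iota> \<in> pm n \<rightarrow> {1..N}"
    and "\<eta> \<in> pm n \<rightarrow> {1, -1}"
  shows "integrable M (\<lambda>\<omega>. \<Prod>k\<in>{1..int n}. quat_entry (T (\<iota> k) (\<iota> (-k)) \<omega>) (\<eta> k) (\<eta> (-k))) \<and>
    prob_space.expectation M
      (\<lambda>\<omega>. \<Prod>k\<in>{1..int n}. quat_entry (T (\<iota> k) (\<iota> (-k)) \<omega>) (\<eta> k) (\<eta> (-k))) =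
    (\<Sum>\<alpha> \<in> {\<alpha> \<in> PM n. (\<forall>k\<in>pm n. \<iota> k = \<iota> (- \<alpha> k)) \<and>
                        (\<forall>k\<in>pm n. sgn k * \<eta> k = sgn (\<alpha> k) * \<eta> (- \<alpha> k))}.
       of_int (\<Prod>k\<in>{k \<in> {1..int n}. -k \<in> FD n \<alpha>}. \<eta> k * \<eta> (-k)) *
       complex_of_real ((2 * real N) powr (real (num_orbits n \<alpha>) / 2 - real n)) *
       f_GSE n \<alpha>)"
proof -
  interpret prob_space M by fact
  obtain G :: "nat \<Rightarrow> nat \<Rightarrow> 'a \<Rightarrow> quat" where
    G: "indep_vars (\<lambda>_. borel) (\<lambda>(i, j). G i j) ({1..N} \<times> {1..N})"
      "\<And>i j. i \<in> {1..N} \<Longrightarrow> j \<in> {1..N} \<Longrightarrow> std_quat_gaussian M (G i j)"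
      "\<And>i j \<omega>. i \<in> {1..N} \<Longrightarrow> j \<in> {1..N} \<Longrightarrow> \<omega> \<in> space M \<Longrightarrow>
         T i j \<omega> = (1 / sqrt (2 * real N)) *\<^sub>R (G i j \<omega> + quat_cnj (G j i \<omega>))"
    using assms(2) unfolding is_GSE_def by blast
  have \<iota>: "\<iota> k \<in> {1..N}" "\<iota> (- k) \<in> {1..N}" and \<eta>: "\<eta> k \<in> {1, -1}" "\<eta> (- k) \<in> {1, -1}"
    if "k \<in> {1..int n}" for k
    using assms(4,5) that by (auto simp: Pi_iff pm_iff)
  have N: "0 < N" using \<iota>(1)[of 1] assms(3) by auto
  let ?A = "({1..N} \<times> {1..N}) \<times> {0..3::nat}"
  let ?K = "{1..int n}" and ?t = "1 / sqrt (2 * real N)"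
  let ?C = "\<lambda>\<alpha>. (\<forall>k\<in>pm n. \<iota> k = \<iota> (- \<alpha> k)) \<and> (\<forall>k\<in>pm n. sgn k * \<eta> k = sgn (\<alpha> k) * \<eta> (- \<alpha> k))"
  let ?P = "\<lambda>\<alpha>. complex_of_int (\<Prod>k\<in>{k \<in> {1..int n}. -k \<in> FD n \<alpha>}. \<eta> k * \<eta> (-k))"
  define X where "X b \<omega> = quat_comp (snd b) ((case fst b of (i, j) \<Rightarrow> G i j) \<omega>)"
    for b :: "(nat \<times> nat) \<times> nat" and \<omega>
  define c where "c k = gse_coeff N (\<iota> k, \<iota> (- k)) (\<eta> k) (\<eta> (- k))" for k
  have "iid_gaussian_moments M (1 / 2) ?A X"
    unfolding X_def using G(1,2)
    by (intro iid_gaussian_moments_Sigma borel_measurable_quat_comp)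
      (auto intro: std_quat_gaussian_moments)
  then have "has_bochner_integral M (\<lambda>\<omega>. \<Prod>k\<in>?K. \<Sum>b\<in>?A. c k b * of_real (X b \<omega>))
      (form_moment (1 / 2) ?A ?K c)"
    by (rule has_bochner_integral_forms) auto
  moreover have "(\<Prod>k\<in>?K. quat_entry (T (\<iota> k) (\<iota> (-k)) \<omega>) (\<eta> k) (\<eta> (-k))) =
      (\<Prod>k\<in>?K. \<Sum>b\<in>?A. c k b * of_real (X b \<omega>))" if \<omega>: "\<omega> \<in> space M" for \<omega>
  proof (intro prod.cong refl)
    fix k assume k: "k \<in> ?K"
    show "quat_entry (T (\<iota> k) (\<iota> (-k)) \<omega>) (\<eta> k) (\<eta> (-k)) = (\<Sum>b\<in>?A. c k b * of_real (X b \<omega>))"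
      unfolding c_def X_def
      by (rule gse_entry_sum[OF \<iota>[OF k], where g = "\<lambda>p. (case p of (i, j) \<Rightarrow> G i j) \<omega>"])
        (simp only: G(3)[OF \<iota>[OF k] \<omega>] prod.case)
  qed
  ultimately have "has_bochner_integral M
      (\<lambda>\<omega>. \<Prod>k\<in>?K. quat_entry (T (\<iota> k) (\<iota> (-k)) \<omega>) (\<eta> k) (\<eta> (-k))) (form_moment (1 / 2) ?A ?K c)"
    by (subst has_bochner_integral_cong[OF refl _ refl]) assumption+
  moreover have "form_moment (1 / 2) ?A ?K c =
      of_real ?t ^ card ?K * (\<Sum>\<alpha>\<in>signed_pairings ?K. pairing_weight (gse_pair_weight \<iota> \<eta>) ?K \<alpha>)"
  proof (rule form_moment_signed_pairings)
    fix k l assume kl: "k \<in> ?K" "l \<in> ?K"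
    show "of_real ((1 / 2)\<^sup>2) * (\<Sum>b\<in>?A. c k b * c l b) =
        (of_real ?t)\<^sup>2 * (gse_pair_weight \<iota> \<eta> k l + gse_pair_weight \<iota> \<eta> k (- l))"
    proof -
      have "0 < l" using kl(2) by simp
      then show ?thesis
        unfolding c_def gse_pair_weight_sum[OF \<open>0 < l\<close>]
        by (intro gse_covariance SigmaI \<iota> \<eta> kl)
    qed
  qed auto
  moreover have "of_real ?t ^ card ?K * (\<Sum>\<alpha>\<in>signed_pairings ?K. pairing_weight (gse_pair_weight \<iota> \<eta>) ?K \<alpha>) =
    (\<Sum>\<alpha> \<in> {\<alpha> \<in> PM n. ?C \<alpha>}. ?P \<alpha> *
       complex_of_real ((2 * real N) powr (real (num_orbits n \<alpha>) / 2 - real n)) * f_GSE n \<alpha>)"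
  proof -
    have cardK: "card ?K = n" by simp
    define C where "C \<alpha> \<longleftrightarrow> ?C \<alpha>" for \<alpha>
    have "(\<Sum>\<alpha> \<in> {\<alpha> \<in> PM n. C \<alpha>}. ?P \<alpha> *
        complex_of_real ((2 * real N) powr (real (num_orbits n \<alpha>) / 2 - real n)) * f_GSE n \<alpha>) =
      (\<Sum>\<alpha> \<in> {\<alpha> \<in> signed_pairings ?K. C \<alpha>}. ?P \<alpha> *
        complex_of_real ((2 * real N) powr (real (num_orbits n \<alpha>) / 2 - real n)))"
      by (rule sum_PM_f_GSE)
    also have "\<dots> = (\<Sum>\<alpha> \<in> {\<alpha> \<in> signed_pairings ?K. C \<alpha>}. of_real ?t ^ n * ?P \<alpha>)"
    proof (intro sum.cong refl)
      fix \<alpha> assume "\<alpha> \<in> {\<alpha> \<in> signed_pairings ?K. C \<alpha>}"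
      then have orb: "num_orbits n \<alpha> = n" by (simp add: num_orbits_pairing)
      have "(2 * real N) powr (real n / 2 - real n) = ?t ^ n"
        using N by (intro powr_half_minus) simp
      then show "?P \<alpha> * complex_of_real ((2 * real N) powr (real (num_orbits n \<alpha>) / 2 - real n)) =
          of_real ?t ^ n * ?P \<alpha>"
        unfolding orb by (simp only: of_real_power mult.commute)
    qed
    also have "\<dots> = (\<Sum>\<alpha>\<in>signed_pairings ?K. if C \<alpha> then of_real ?t ^ n * ?P \<alpha> else 0)"
      by (rule sum.inter_filter) (simp add: finite_signed_pairings)
    also have "\<dots> = (\<Sum>\<alpha>\<in>signed_pairings ?K. of_real ?t ^ n * pairing_weight (gse_pair_weight \<iota> \<eta>) ?K \<alpha>)"
    proof (intro sum.cong refl)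
      fix \<alpha> assume "\<alpha> \<in> signed_pairings ?K"
      then have "pairing_weight (gse_pair_weight \<iota> \<eta>) ?K \<alpha> = (if C \<alpha> then ?P \<alpha> else 0)"
        unfolding C_def by (rule pairing_weight_gse)
      then show "(if C \<alpha> then of_real ?t ^ n * ?P \<alpha> else 0) =
          of_real ?t ^ n * pairing_weight (gse_pair_weight \<iota> \<eta>) ?K \<alpha>"
        by (simp only: if_distrib[of "(*) _"] mult_zero_right)
    qed
    finally show ?thesis
      unfolding C_def cardK by (simp only: sum_distrib_left)
  qed
  ultimately show ?thesis by (simp only: has_bochner_integral_iff)
qed

end
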